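(* Let $n\geqslant 3$ be an integer and let $A_1,\ldots,A_n$ be Hermitian positive semidefinite complex matrices of the same size. For $k=1,\ldots,n$ let $$s_k := \sum_{1\leqslant i_1<i_2<\cdots<i_k\leqslant n}\det(A_{i_1}+\cdots+A_{i_k}).$$ Then $$s_n + s_{n-2} + s_{n-4}+\cdots \ \geqslant\ s_{n-1}+s_{n-3}+s_{n-5}+\cdots,$$ where on each side the sum runs over all indices $k\geqslant 1$ of the indicated parity (that is, $k\equiv n\pmod 2$ with $1\leqslant k\leqslant n$ on the left, and $k\equiv n-1\pmod 2$ with $1\leqslant k\leqslant n-1$ on the right). *)

theory Defs
  imports "HOL-Analysis.Analysis"
begin

definition hermitian_matrix :: "complex^'m^'m \<Rightarrow> bool" where
  "hermitian_matrix A \<longleftrightarrow> map_matrix cnj (transpose A) = A"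

(* The order on complex is that of HOL-Library.Complex_Order: x \<le> y means
   Re x \<le> Re y and Im x = Im y, so 0 \<le> z says that z is real and nonnegative. *)
definition psd_matrix :: "complex^'m^'m \<Rightarrow> bool" where
  "psd_matrix A \<longleftrightarrow>
     hermitian_matrix A \<and> (\<forall>x. 0 \<le> (\<Sum>i\<in>UNIV. cnj (x $ i) * (A *v x) $ i))"

(* Strictly increasing sequences i_1 < ... < i_k in {1..n} are encoded as the
   k-element subsets of {1..n}. *)
definition det_subset_sum :: "(nat \<Rightarrow> complex^'m^'m) \<Rightarrow> nat \<Rightarrow> nat \<Rightarrow> complex" where
  "det_subset_sum A n k = (\<Sum>I | I \<subseteq> {1..n} \<and> card I = k. det (\<Sum>i\<in>I. A i))"

end

theory Submission
  imports Defs
begin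

text \<open>
  The difference of the two sides is the alternating sum of \<open>det (\<Sum>i\<in>I. A i)\<close> over the
  nonempty subsets \<open>I\<close> of \<open>{1..n}\<close>, with sign \<open>+\<close> at \<open>I = {1..n}\<close>; since the matrices have
  positive size, \<open>I = {}\<close> may be included. Hence, by Moebius inversion, it is enough to write
  \<open>det (\<Sum>i\<in>I. A i) = (\<Sum>J\<in>Pow I. w J)\<close> with nonnegative weights \<open>w J\<close>: the difference is
  then the single weight \<open>w {1..n}\<close>.

  Such weights come from a Cauchy--Binet expansion. Each \<open>A i\<close> is a sum of rank-one matrices
  \<open>v v\<^sup>*\<close> (\<open>psd_matrix_rank_one_sum\<close>), so \<open>\<Sum>i\<in>I. A i\<close> is the sum of \<open>v v\<^sup>*\<close> over all vectors
  \<open>v\<close> that belong to an index in \<open>I\<close>. The determinant of a sum of rank-one matrices is, up to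
  the factor \<open>1 / m!\<close>, the sum of \<open>\<bar>det (v\<^sub>1, \<dots>, v\<^sub>m)\<bar>\<^sup>2\<close> over all ways to choose
  one of the vectors for each of \<open>m\<close> rows, where \<open>m\<close> is the size of the matrices
  (\<open>det_sum_rank_one\<close>). Sorting the choices by the set \<open>J\<close> of indices to which the chosen
  vectors belong gives \<open>w J\<close>.
\<close>

section \<open>Positive semidefinite matrices as sums of rank-one matrices\<close>

definition herm_form :: "complex^'m^'m \<Rightarrow> complex^'m \<Rightarrow> complex" where
  "herm_form M x = (\<Sum>i\<in>UNIV. cnj (x $ i) * (M *v x) $ i)"

lemma hermitian_matrix_entry:
  assumes "hermitian_matrix M"
  shows "cnj (M $ a $ b) = M $ b $ a"
proof -
  have "map_matrix cnj (transpose M) $ b $ a = M $ b $ a"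
    using assms by (simp add: hermitian_matrix_def)
  then show ?thesis by (simp add: transpose_def)
qed

lemma herm_form_diff_axis:
  fixes M :: "complex^'m^'m"
  assumes "hermitian_matrix M"
  shows "herm_form M (x - axis s t) =
         herm_form M x - t * cnj ((M *v x) $ s) - cnj t * (M *v x) $ s + cnj t * t * M $ s $ s"
proof -
  have mv: "(M *v (x - axis s t)) $ i = (M *v x) $ i - M $ i $ s * t" for i
  proof -
    have "(M *v axis s t) $ i = M $ i $ s * t"
      by (simp add: matrix_vector_mult_def axis_def if_distrib cong: if_cong)
    then show ?thesis by (simp add: matrix_vector_mult_diff_distrib)
  qed
  have cross: "(\<Sum>i\<in>UNIV. cnj (x $ i) * M $ i $ s) = cnj ((M *v x) $ s)"
    using hermitian_matrix_entry[OF assms]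
    by (simp add: matrix_vector_mult_def cnj_sum mult.commute)
  have pick: "(\<Sum>i\<in>UNIV. cnj (axis s t $ i) * g i) = cnj t * g s" for g :: "'m \<Rightarrow> complex"
  proof -
    have "(\<Sum>i\<in>UNIV. cnj (axis s t $ i) * g i) = (\<Sum>i\<in>UNIV. if i = s then cnj t * g i else 0)"
      by (rule sum.cong) (auto simp: axis_def)
    then show ?thesis by simp
  qed
  have "herm_form M (x - axis s t) =
     (\<Sum>i\<in>UNIV. cnj (x $ i) * (M *v x) $ i) - t * (\<Sum>i\<in>UNIV. cnj (x $ i) * M $ i $ s)
     - (\<Sum>i\<in>UNIV. cnj (axis s t $ i) * ((M *v x) $ i - M $ i $ s * t))"
    unfolding herm_form_def mv sum_distrib_left
    by (simp add: algebra_simps sum_subtractf sum.distrib)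
  then show ?thesis
    unfolding cross pick herm_form_def[symmetric] by (simp add: algebra_simps)
qed

lemma psd_matrix_diag_nonneg:
  assumes "psd_matrix M"
  shows "0 \<le> M $ s $ s"
proof -
  have "0 \<le> herm_form M (0 - axis s 1)"
    using assms unfolding psd_matrix_def herm_form_def by blast
  also have "\<dots> = M $ s $ s"
    using assms by (subst herm_form_diff_axis) (simp_all add: psd_matrix_def herm_form_def)
  finally show ?thesis .
qed

text \<open>If \<open>M $ a $ s\<close> did not vanish, then moving the \<open>a\<close>-th unit vector far along the \<open>s\<close>-axis
  would decrease the form at a constant positive rate, because the quadratic term
  has the coefficient \<open>M $ s $ s = 0\<close>; the form would become negative.\<close>

lemma psd_matrix_zero_diag:
  assumes psd: "psd_matrix M" and zero: "M $ s $ s = 0"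
  shows "M $ s $ a = 0"
proof (rule ccontr)
  assume nz: "M $ s $ a \<noteq> 0"
  define c where "c = (cmod (M $ s $ a))\<^sup>2"
  have c: "c > 0" using nz by (simp add: c_def)
  define r where "r = (Re (M $ a $ a) + 1) / c"
  let ?x = "axis a 1 :: complex^'a"
  have herm: "hermitian_matrix M" using psd by (simp add: psd_matrix_def)
  have mv: "(M *v ?x) $ i = M $ i $ a" for i
    by (simp add: matrix_vector_mult_def axis_def if_distrib cong: if_cong)
  have form: "herm_form M ?x = M $ a $ a"
  proof -
    have "herm_form M ?x = (\<Sum>i\<in>UNIV. if i = a then M $ i $ a else 0)"
      unfolding herm_form_def mv by (rule sum.cong) (auto simp: axis_def)
    then show ?thesis by simp
  qed
  have "0 \<le> herm_form M (?x - axis s (of_real r * M $ s $ a))"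
    using psd unfolding psd_matrix_def herm_form_def by blast
  also have "\<dots> = M $ a $ a - 2 * of_real r * (M $ s $ a * cnj (M $ s $ a))"
    unfolding herm_form_diff_axis[OF herm] mv form zero by (simp add: algebra_simps)
  also have "M $ s $ a * cnj (M $ s $ a) = of_real c"
    by (simp only: c_def complex_norm_square)
  finally have "0 \<le> Re (M $ a $ a) - 2 * (r * c)"
    by (simp add: less_eq_complex_def)
  moreover have "r * c = Re (M $ a $ a) + 1" using c by (simp add: r_def)
  moreover have "0 \<le> Re (M $ a $ a)"
    using psd_matrix_diag_nonneg[OF psd, of a] by (simp add: less_eq_complex_def)
  ultimately show False by linarith
qed

text \<open>The Schur complement of the entry \<open>M $ s $ s\<close> has at \<open>x\<close> the value that \<open>M\<close> takes at the
  vector obtained from \<open>x\<close> by minimising the form along the \<open>s\<close>-axis.\<close>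

lemma psd_matrix_schur_complement:
  assumes psd: "psd_matrix M" and nz: "M $ s $ s \<noteq> 0"
  shows "psd_matrix (\<chi> a b. M $ a $ b - M $ a $ s * M $ s $ b / M $ s $ s)"
    (is "psd_matrix ?N")
proof -
  have herm: "hermitian_matrix M" using psd by (simp add: psd_matrix_def)
  note entry = hermitian_matrix_entry[OF herm]
  have "hermitian_matrix ?N"
    by (simp add: hermitian_matrix_def vec_eq_iff transpose_def entry mult.commute)
  moreover have "0 \<le> herm_form ?N x" for x
  proof -
    define w where "w = (M *v x) $ s"
    have mv: "(?N *v x) $ i = (M *v x) $ i - M $ i $ s * (w / M $ s $ s)" for i
      by (simp add: w_def matrix_vector_mult_def left_diff_distrib sum_subtractf sum_distrib_left
          sum_divide_distrib mult.assoc)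
    have cross: "(\<Sum>i\<in>UNIV. cnj (x $ i) * M $ i $ s) = cnj w"
      by (simp add: w_def matrix_vector_mult_def cnj_sum entry mult.commute)
    have "herm_form ?N x = herm_form M x - (\<Sum>i\<in>UNIV. cnj (x $ i) * M $ i $ s) * (w / M $ s $ s)"
      unfolding herm_form_def mv sum_distrib_right
      by (simp add: algebra_simps sum_subtractf)
    also have "\<dots> = herm_form M (x - axis s (w / M $ s $ s))"
      unfolding herm_form_diff_axis[OF herm] cross w_def[symmetric]
      using nz by (simp add: entry field_simps)
    also have "0 \<le> \<dots>"
      using psd unfolding psd_matrix_def herm_form_def by blast
    finally show ?thesis .
  qed
  ultimately show ?thesis
    by (auto simp: psd_matrix_def herm_form_def)
qed

text \<open>Splitting off one Schur complement clears one row and column, so the induction runs over a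
  set of indices that contains all nonzero rows.\<close>

lemma psd_matrix_rank_one_sum_support:
  fixes M :: "complex^'m^'m"
  assumes "finite S" "psd_matrix M" "\<And>a b. a \<notin> S \<Longrightarrow> M $ a $ b = 0"
  shows "\<exists>V :: 'm \<Rightarrow> 'm \<Rightarrow> complex. \<forall>a b. M $ a $ b = (\<Sum>c\<in>S. V c a * cnj (V c b))"
  using assms
proof (induction S arbitrary: M rule: finite_induct)
  case empty
  then show ?case by simp
next
  case (insert s S)
  note psd = insert.prems(1)
  have herm: "hermitian_matrix M" using psd by (simp add: psd_matrix_def)
  note entry = hermitian_matrix_entry[OF herm]
  show ?case
  proof (cases "M $ s $ s = 0")
    case True
    have "M $ a $ b = 0" if "a \<notin> S" for a b
      using that insert.prems(2)[of a b] psd_matrix_zero_diag[OF psd True]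
      by (cases "a = s") auto
    from insert.IH[OF psd this] obtain V :: "'m \<Rightarrow> 'm \<Rightarrow> complex"
      where V: "\<And>a b. M $ a $ b = (\<Sum>c\<in>S. V c a * cnj (V c b))" by blast
    have "M $ a $ b = (\<Sum>c\<in>insert s S. (V(s := \<lambda>_. 0)) c a * cnj ((V(s := \<lambda>_. 0)) c b))" for a b
      using insert.hyps by (auto simp: V intro!: sum.cong)
    then show ?thesis by blast
  next
    case False
    define N where "N = (\<chi> a b. M $ a $ b - M $ a $ s * M $ s $ b / M $ s $ s)"
    define d where "d = Re (M $ s $ s)"
    have d: "M $ s $ s = of_real d" "d > 0"
      using psd_matrix_diag_nonneg[OF psd, of s] False
      by (auto simp: d_def less_eq_complex_def complex_eq_iff)
    define u where "u = (\<lambda>a. M $ a $ s / of_real (sqrt d))"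
    have uu: "u a * cnj (u b) = M $ a $ s * M $ s $ b / M $ s $ s" for a b
    proof -
      have "(of_real (sqrt d) * of_real (sqrt d) :: complex) = of_real d"
        using d(2) by (simp flip: of_real_mult)
      then show ?thesis by (simp add: u_def d(1) entry)
    qed
    have "psd_matrix N"
      unfolding N_def by (rule psd_matrix_schur_complement[OF psd False])
    moreover have "N $ a $ b = 0" if "a \<notin> S" for a b
    proof (cases "a = s")
      case True
      then show ?thesis using False by (simp add: N_def)
    next
      case a: False
      then show ?thesis using that insert.prems(2)[of a] by (simp add: N_def)
    qed
    ultimately obtain V :: "'m \<Rightarrow> 'm \<Rightarrow> complex"
      where V: "\<And>a b. N $ a $ b = (\<Sum>c\<in>S. V c a * cnj (V c b))"
      using insert.IH[of N] by blast
    have "M $ a $ b = (\<Sum>c\<in>insert s S. (V(s := u)) c a * cnj ((V(s := u)) c b))" for a b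
    proof -
      have "(\<Sum>c\<in>insert s S. (V(s := u)) c a * cnj ((V(s := u)) c b))
            = u a * cnj (u b) + (\<Sum>c\<in>S. (V(s := u)) c a * cnj ((V(s := u)) c b))"
        using insert.hyps by simp
      also have "(\<Sum>c\<in>S. (V(s := u)) c a * cnj ((V(s := u)) c b)) = N $ a $ b"
        unfolding V using insert.hyps by (intro sum.cong) auto
      finally show ?thesis by (simp add: uu N_def)
    qed
    then show ?thesis by blast
  qed
qed

lemma psd_matrix_rank_one_sum:
  fixes M :: "complex^'m^'m"
  assumes "psd_matrix M"
  obtains V :: "'m \<Rightarrow> 'm \<Rightarrow> complex"
    where "\<And>a b. M $ a $ b = (\<Sum>c\<in>UNIV. V c a * cnj (V c b))"
  using psd_matrix_rank_one_sum_support[of UNIV M] assms by auto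

section \<open>The determinant of a sum of rank-one matrices\<close>

lemma det_rows_sum_expand:
  fixes a :: "'n::finite \<Rightarrow> 'k \<Rightarrow> 'a::comm_ring_1^'n"
  assumes fin: "finite T"
  shows "det (\<chi> i. \<Sum>k\<in>T. a i k) = (\<Sum>f | \<forall>i. f i \<in> T. det (\<chi> i. a i (f i)))"
proof -
  have funs: "(UNIV :: 'n set) \<rightarrow>\<^sub>E T = {f. \<forall>i. f i \<in> T}"
    by (auto simp: PiE_iff)
  have "det (\<chi> i. \<Sum>k\<in>T. a i k)
        = (\<Sum>p | p permutes (UNIV :: 'n set). of_int (sign p) * (\<Prod>i\<in>UNIV. \<Sum>k\<in>T. a i k $ p i))"
    by (simp add: det_def)
  also have "\<dots> = (\<Sum>p | p permutes (UNIV :: 'n set). \<Sum>f | \<forall>i. f i \<in> T.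
                   of_int (sign p) * (\<Prod>i\<in>UNIV. a i (f i) $ p i))"
    using fin by (simp add: prod_sum_PiE funs sum_distrib_left)
  also have "\<dots> = (\<Sum>f | \<forall>i. f i \<in> T. det (\<chi> i. a i (f i)))"
    by (subst sum.swap) (simp add: det_def)
  finally show ?thesis .
qed

text \<open>This is the Cauchy--Binet formula for \<open>V V\<^sup>*\<close>. Summing over all maps \<open>f\<close>, rather than over
  \<open>m\<close>-element sets of vectors, counts each set \<open>m!\<close> times; maps that are not injective contribute
  zero. Row multilinearity gives a sum over \<open>f\<close> with the factor \<open>\<Prod>a. v (f a) a\<close> in place of a
  determinant; averaging over the substitutions \<open>f \<mapsto> f \<circ> p\<close> turns this product into one.\<close>

lemma det_sum_rank_one:
  fixes v :: "'k \<Rightarrow> 'm::finite \<Rightarrow> complex"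
  assumes fin: "finite T"
  shows "det (\<chi> a b. \<Sum>k\<in>T. v k a * cnj (v k b)) =
         (\<Sum>f | \<forall>a. f a \<in> T. of_real ((cmod (det (\<chi> a b. v (f a) b)))\<^sup>2)) / fact CARD('m)"
proof -
  let ?F = "{f :: 'm \<Rightarrow> 'k. \<forall>a. f a \<in> T}"
  let ?P = "{p. p permutes (UNIV :: 'm set)}"
  define D where "D f = det (\<chi> a b. v (f a) b)" for f :: "'m \<Rightarrow> 'k"
  define g where "g f = (\<Prod>a\<in>UNIV. v (f a) a)" for f :: "'m \<Rightarrow> 'k"
  have cnj_det: "det (\<chi> a b. cnj (v (f a) b)) = cnj (D f)" for f
    by (simp add: D_def det_def cnj_sum cnj_prod)
  have D_perm: "D (f \<circ> p) = of_int (sign p) * D f" if "p permutes UNIV" for f p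
    using det_permute_rows[OF that, of "\<chi> a b. v (f a) b"] by (simp add: D_def)
  have D_expand: "D f = (\<Sum>p\<in>?P. of_int (sign p) * g (f \<circ> p))" for f
  proof -
    have "D f = det (transpose (\<chi> a b. v (f a) b))"
      by (simp add: D_def det_transpose)
    then show ?thesis
      by (simp add: det_def transpose_def g_def)
  qed
  have "det (\<chi> a b. \<Sum>k\<in>T. v k a * cnj (v k b))
        = det (\<chi> a. \<Sum>k\<in>T. v k a *s (\<chi> b. cnj (v k b)))"
    by (rule arg_cong[of _ _ det]) (simp add: vec_eq_iff)
  also have "\<dots> = (\<Sum>f\<in>?F. det (\<chi> a. v (f a) a *s (\<chi> b. cnj (v (f a) b))))"
    by (rule det_rows_sum_expand[OF fin])
  also have "\<dots> = (\<Sum>f\<in>?F. g f * cnj (D f))"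
    by (simp add: det_rows_mul g_def cnj_det)
  finally have det_eq:
    "det (\<chi> a b. \<Sum>k\<in>T. v k a * cnj (v k b)) = (\<Sum>f\<in>?F. g f * cnj (D f))" .
  have perm_inv: "(\<Sum>f\<in>?F. g f * cnj (D f)) = (\<Sum>f\<in>?F. of_int (sign p) * g (f \<circ> p) * cnj (D f))"
    if p: "p permutes UNIV" for p
  proof -
    have "(\<Sum>f\<in>?F. g f * cnj (D f)) = (\<Sum>f\<in>?F. g (f \<circ> p) * cnj (D (f \<circ> p)))"
    proof (rule sum.reindex_bij_witness[of _ "\<lambda>f. f \<circ> p" "\<lambda>f. f \<circ> inv p"])
    qed (auto simp: fun_eq_iff permutes_inverses[OF p] o_def)
    then show ?thesis
      by (simp add: D_perm[OF p] mult_ac)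
  qed
  have "fact CARD('m) * (\<Sum>f\<in>?F. g f * cnj (D f)) = (\<Sum>p\<in>?P. \<Sum>f\<in>?F. g f * cnj (D f))"
    by (simp add: card_permutations[OF refl])
  also have "\<dots> = (\<Sum>p\<in>?P. \<Sum>f\<in>?F. of_int (sign p) * g (f \<circ> p) * cnj (D f))"
    by (rule sum.cong[OF refl]) (simp only: mem_Collect_eq perm_inv)
  also have "\<dots> = (\<Sum>f\<in>?F. (\<Sum>p\<in>?P. of_int (sign p) * g (f \<circ> p)) * cnj (D f))"
    unfolding sum_distrib_right by (rule sum.swap)
  also have "\<dots> = (\<Sum>f\<in>?F. D f * cnj (D f))"
    by (simp only: D_expand[symmetric])
  also have "\<dots> = (\<Sum>f\<in>?F. of_real ((cmod (D f))\<^sup>2))"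
    by (simp only: complex_norm_square)
  finally show ?thesis
    by (simp add: det_eq D_def field_simps)
qed

section \<open>The alternating sum\<close>

text \<open>The weight of \<open>J\<close> collects the choices of vectors that involve exactly the matrices with
  index in \<open>J\<close>.\<close>

lemma det_sum_psd_weights:
  fixes A :: "'i \<Rightarrow> complex^'m^'m"
  assumes psd: "\<And>i. i \<in> X \<Longrightarrow> psd_matrix (A i)" and fin: "finite X"
  obtains w :: "'i set \<Rightarrow> complex"
    where "\<And>J. 0 \<le> w J"
      and "\<And>I. I \<subseteq> X \<Longrightarrow> det (\<Sum>i\<in>I. A i) = (\<Sum>J\<in>Pow I. w J)"
proof -
  have "\<forall>i\<in>X. \<exists>V :: 'm \<Rightarrow> 'm \<Rightarrow> complex. \<forall>a b. A i $ a $ b = (\<Sum>c\<in>UNIV. V c a * cnj (V c b))"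
    using psd psd_matrix_rank_one_sum by metis
  then obtain V :: "'i \<Rightarrow> 'm \<Rightarrow> 'm \<Rightarrow> complex"
    where V: "\<And>i a b. i \<in> X \<Longrightarrow> A i $ a $ b = (\<Sum>c\<in>UNIV. V i c a * cnj (V i c b))"
    by metis
  define v where "v = (\<lambda>(i, c). V i c)"
  define h :: "('m \<Rightarrow> 'i \<times> 'm) \<Rightarrow> complex"
    where "h f = of_real ((cmod (det (\<chi> a b. v (f a) b)))\<^sup>2) / fact CARD('m)" for f
  define w where "w J = (\<Sum>f | range (fst \<circ> f) = J. h f)" for J
  have h_nonneg: "0 \<le> h f" for f
  proof -
    have "h f = of_real ((cmod (det (\<chi> a b. v (f a) b)))\<^sup>2 / fact CARD('m))"
      by (simp add: h_def)
    moreover have "0 \<le> (complex_of_real r)" if "0 \<le> r" for r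
      using that by (simp add: less_eq_complex_def)
    ultimately show ?thesis by (metis divide_nonneg_nonneg fact_ge_zero zero_le_power2)
  qed
  show thesis
  proof
    show "0 \<le> w J" for J
      unfolding w_def by (intro sum_nonneg h_nonneg)
  next
    fix I assume I: "I \<subseteq> X"
    have finI: "finite I" using I fin by (rule finite_subset)
    let ?F = "{f :: 'm \<Rightarrow> 'i \<times> 'm. \<forall>a. f a \<in> I \<times> UNIV}"
    have finF: "finite ?F"
      using finite_set_of_finite_funs[of "UNIV :: 'm set" "I \<times> (UNIV :: 'm set)"] finI by simp
    have "(\<Sum>i\<in>I. A i) = (\<chi> a b. \<Sum>k\<in>I \<times> UNIV. v k a * cnj (v k b))"
    proof -
      have "(\<Sum>i\<in>I. A i) $ a $ b = (\<Sum>k\<in>I \<times> UNIV. v k a * cnj (v k b))" for a b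
      proof -
        have "(\<Sum>i\<in>I. A i) $ a $ b = (\<Sum>i\<in>I. \<Sum>c\<in>UNIV. V i c a * cnj (V i c b))"
          using I V by (auto simp: intro!: sum.cong)
        then show ?thesis
          by (simp add: sum.cartesian_product v_def case_prod_unfold)
      qed
      then show ?thesis by (simp add: vec_eq_iff)
    qed
    then have "det (\<Sum>i\<in>I. A i) = (\<Sum>f\<in>?F. h f)"
      using finI by (simp add: det_sum_rank_one h_def sum_divide_distrib)
    also have "\<dots> = (\<Sum>J\<in>Pow I. \<Sum>f | f \<in> ?F \<and> range (fst \<circ> f) = J. h f)"
      by (rule sum.group[symmetric]) (use finF finI in \<open>auto simp: mem_Times_iff\<close>)
    also have "\<dots> = (\<Sum>J\<in>Pow I. w J)"
      unfolding w_def by (intro sum.cong) (auto simp: mem_Times_iff)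
    finally show "det (\<Sum>i\<in>I. A i) = (\<Sum>J\<in>Pow I. w J)" .
  qed
qed

lemma det_alternating_sum_psd_nonneg:
  fixes A :: "'i \<Rightarrow> complex^'m^'m"
  assumes psd: "\<And>i. i \<in> X \<Longrightarrow> psd_matrix (A i)" and fin: "finite X"
  shows "0 \<le> (\<Sum>I\<in>Pow X. (-1) ^ (card X - card I) * det (\<Sum>i\<in>I. A i))"
proof -
  obtain w :: "'i set \<Rightarrow> complex" where w: "\<And>J. 0 \<le> w J"
    and det_w: "\<And>I. I \<subseteq> X \<Longrightarrow> det (\<Sum>i\<in>I. A i) = (\<Sum>J\<in>Pow I. w J)"
    by (rule det_sum_psd_weights[where X = X and A = A, OF psd fin]) (simp, rule that)
  have "w X = (\<Sum>I\<in>Pow X. (-1) ^ (card X - card I) * (\<Sum>J\<in>Pow I. w J))"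
    by (rule inclusion_exclusion_mobius[OF refl fin])
  then show ?thesis
    using w[of X] by (simp add: det_w)
qed

lemma det_subset_sum_alternating:
  fixes A :: "nat \<Rightarrow> complex^'m^'m"
  shows "(\<Sum>k\<in>{1..n}. (-1) ^ (n - k) * det_subset_sum A n k)
         = (\<Sum>I\<in>Pow {1..n}. (-1) ^ (n - card I) * det (\<Sum>i\<in>I. A i))"
proof -
  let ?t = "\<lambda>I. (-1) ^ (n - card I) * det (\<Sum>i\<in>I. A i)"
  have "(\<Sum>I\<in>Pow {1..n}. ?t I) = (\<Sum>I\<in>Pow {1..n} - {{}}. ?t I)"
    \<comment> \<open>A matrix has at least one row, so \<open>det 0 = 0\<close>.\<close>
    using det_0[where 'a = complex and 'n = 'm]
    by (subst sum.remove[of _ "{}"]) (auto simp: mat_0)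
  also have "\<dots> = (\<Sum>k\<in>{1..n}. \<Sum>I | I \<in> Pow {1..n} - {{}} \<and> card I = k. ?t I)"
  proof (rule sum.group[symmetric])
    show "card ` (Pow {1..n} - {{}}) \<subseteq> {1..n}"
    proof
      fix k assume "k \<in> card ` (Pow {1..n} - {{}})"
      then obtain I where I: "I \<subseteq> {1..n}" "I \<noteq> {}" "k = card I" by auto
      have "card I \<le> n" using card_mono[OF _ I(1)] by simp
      moreover have "card I \<noteq> 0" using I finite_subset[OF I(1)] by simp
      ultimately show "k \<in> {1..n}" using I(3) by simp
    qed
  qed auto
  also have "\<dots> = (\<Sum>k\<in>{1..n}. (-1) ^ (n - k) * det_subset_sum A n k)"
    unfolding det_subset_sum_def sum_distrib_left
    by (intro sum.cong) auto
  finally show ?thesis by simp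
qed

theorem corollary3p4:
  fixes A :: "nat \<Rightarrow> complex^'m^'m" and n :: nat
  assumes "n \<ge> 3"
    and "\<And>i. i \<in> {1..n} \<Longrightarrow> psd_matrix (A i)"
  shows "(\<Sum>k | k \<in> {1..n} \<and> k mod 2 = n mod 2. det_subset_sum A n k)
       \<ge> (\<Sum>k | k \<in> {1..n - 1} \<and> k mod 2 = (n - 1) mod 2. det_subset_sum A n k)"
proof -
  let ?s = "det_subset_sum A n"
  let ?E = "{k. k \<in> {1..n} \<and> k mod 2 = n mod 2}"
  let ?O = "{k. k \<in> {1..n - 1} \<and> k mod 2 = (n - 1) mod 2}"
  have parity: "j mod 2 = k mod 2 \<longleftrightarrow> (even j \<longleftrightarrow> even k)" for j k :: nat
    by presburger
  have E: "?E = {k \<in> {1..n}. even (n - k)}"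
    by (auto simp: parity)
  have O: "?O = {k \<in> {1..n}. odd (n - k)}"
  proof -
    obtain m where m: "n = Suc m" using assms(1) by (cases n) auto
    show ?thesis by (auto simp: m parity le_Suc_eq)
  qed
  have split: "{1..n} = ?E \<union> ?O" "?E \<inter> ?O = {}"
    unfolding E O by auto
  have "(\<Sum>k\<in>{1..n}. (-1) ^ (n - k) * ?s k)
      = (\<Sum>k\<in>?E. (-1) ^ (n - k) * ?s k) + (\<Sum>k\<in>?O. (-1) ^ (n - k) * ?s k)"
    by (subst split(1), rule sum.union_disjoint) (use split(2) in auto)
  also have "(\<Sum>k\<in>?E. (-1) ^ (n - k) * ?s k) = (\<Sum>k\<in>?E. ?s k)"
  proof (rule sum.cong[OF refl])
    fix k assume "k \<in> ?E"
    then have "even (n - k)" unfolding E by blast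
    then show "(-1) ^ (n - k) * ?s k = ?s k" by simp
  qed
  also have "(\<Sum>k\<in>?O. (-1) ^ (n - k) * ?s k) = - (\<Sum>k\<in>?O. ?s k)"
    unfolding sum_negf[symmetric]
  proof (rule sum.cong[OF refl])
    fix k assume "k \<in> ?O"
    then have "odd (n - k)" unfolding O by blast
    then show "(-1) ^ (n - k) * ?s k = - ?s k" by simp
  qed
  finally have "(\<Sum>k\<in>{1..n}. (-1) ^ (n - k) * ?s k) = (\<Sum>k\<in>?E. ?s k) - (\<Sum>k\<in>?O. ?s k)"
    by simp
  moreover have "0 \<le> (\<Sum>k\<in>{1..n}. (-1) ^ (n - k) * ?s k)"
    using det_alternating_sum_psd_nonneg[of "{1..n}" A, OF assms(2)]
    unfolding det_subset_sum_alternating by simp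
  ultimately show ?thesis by simp
qed

end
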